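(* (In ZF, i.e. without the Axiom of Choice.) For any sets $A$ and $B$: $B \ll A$ if and only if there is an injection from $B \times \omega$ into $A$.
   Context: All reasoning takes place in ZF without the Axiom of Choice. $\omega=\{0,1,2,\ldots\}$ is the set of natural numbers. For sets $X,Y$, $X+Y$ denotes the disjoint union $(\{0\}\times X)\cup(\{1\}\times Y)$. We write $B \ll A$ (equivalently $A \gg B$, "$A$ swallows $B$") if there is a bijection between $A+B$ and $A$. *)

theory Defs
  imports Main
begin

text \<open>
  Isabelle/HOL itself contains a choice operator, so sets of HOL cannot express that a statement is
  a theorem of ZF without choice. We therefore work in an arbitrary model of first-order ZF: the
  universe is a type \<^typ>\<open>'v\<close> with a binary relation \<open>E\<close> as membership, and all notions below are
  interpreted inside the model. The schemes of Separation and Replacement range over first-order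
  formulas only; with arbitrary HOL predicates in their place the choice principle of HOL would
  carry over to the model.
\<close>

datatype fm = Mem nat nat | Eq nat nat | Neg fm | Conj fm fm | All nat fm

fun sat :: "('v \<Rightarrow> 'v \<Rightarrow> bool) \<Rightarrow> (nat \<Rightarrow> 'v) \<Rightarrow> fm \<Rightarrow> bool" where
  "sat E s (Mem i j) \<longleftrightarrow> E (s i) (s j)"
| "sat E s (Eq i j) \<longleftrightarrow> s i = s j"
| "sat E s (Neg \<phi>) \<longleftrightarrow> \<not> sat E s \<phi>"
| "sat E s (Conj \<phi> \<psi>) \<longleftrightarrow> sat E s \<phi> \<and> sat E s \<psi>"
| "sat E s (All i \<phi>) \<longleftrightarrow> (\<forall>a. sat E (s(i := a)) \<phi>)"

context
  fixes E :: "'v \<Rightarrow> 'v \<Rightarrow> bool"  (infix \<open>\<in>\<^sub>M\<close> 50)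
begin

definition is_empty :: "'v \<Rightarrow> bool" where
  "is_empty z \<longleftrightarrow> (\<forall>x. \<not> x \<in>\<^sub>M z)"

definition is_succ :: "'v \<Rightarrow> 'v \<Rightarrow> bool" where
  "is_succ s x \<longleftrightarrow> (\<forall>y. y \<in>\<^sub>M s \<longleftrightarrow> y \<in>\<^sub>M x \<or> y = x)"

definition is_one :: "'v \<Rightarrow> bool" where
  "is_one u \<longleftrightarrow> (\<exists>z. is_empty z \<and> is_succ u z)"

definition is_inductive :: "'v \<Rightarrow> bool" where
  "is_inductive w \<longleftrightarrow>
     (\<exists>z. is_empty z \<and> z \<in>\<^sub>M w) \<and> (\<forall>x. x \<in>\<^sub>M w \<longrightarrow> (\<exists>s. is_succ s x \<and> s \<in>\<^sub>M w))"

definition is_omega :: "'v \<Rightarrow> bool" where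
  "is_omega w \<longleftrightarrow>
     is_inductive w \<and> (\<forall>u. is_inductive u \<longrightarrow> (\<forall>x. x \<in>\<^sub>M w \<longrightarrow> x \<in>\<^sub>M u))"

definition is_upair :: "'v \<Rightarrow> 'v \<Rightarrow> 'v \<Rightarrow> bool" where
  "is_upair p a b \<longleftrightarrow> (\<forall>x. x \<in>\<^sub>M p \<longleftrightarrow> x = a \<or> x = b)"

text \<open>Kuratowski pairs.\<close>

definition is_pair :: "'v \<Rightarrow> 'v \<Rightarrow> 'v \<Rightarrow> bool" where
  "is_pair p a b \<longleftrightarrow> (\<exists>u v. is_upair u a a \<and> is_upair v a b \<and> is_upair p u v)"

definition is_product :: "'v \<Rightarrow> 'v \<Rightarrow> 'v \<Rightarrow> bool" where
  "is_product P X Y \<longleftrightarrow>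
     (\<forall>p. p \<in>\<^sub>M P \<longleftrightarrow> (\<exists>x y. x \<in>\<^sub>M X \<and> y \<in>\<^sub>M Y \<and> is_pair p x y))"

definition is_disjoint_union :: "'v \<Rightarrow> 'v \<Rightarrow> 'v \<Rightarrow> bool" where
  "is_disjoint_union S X Y \<longleftrightarrow>
     (\<forall>p. p \<in>\<^sub>M S \<longleftrightarrow>
        (\<exists>z x. is_empty z \<and> x \<in>\<^sub>M X \<and> is_pair p z x) \<or>
        (\<exists>u y. is_one u \<and> y \<in>\<^sub>M Y \<and> is_pair p u y))"

definition maps_to :: "'v \<Rightarrow> 'v \<Rightarrow> 'v \<Rightarrow> bool" where
  "maps_to f x y \<longleftrightarrow> (\<exists>p. is_pair p x y \<and> p \<in>\<^sub>M f)"

definition is_function :: "'v \<Rightarrow> 'v \<Rightarrow> 'v \<Rightarrow> bool" where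
  "is_function f X Y \<longleftrightarrow>
     (\<forall>p. p \<in>\<^sub>M f \<longrightarrow> (\<exists>x y. x \<in>\<^sub>M X \<and> y \<in>\<^sub>M Y \<and> is_pair p x y)) \<and>
     (\<forall>x. x \<in>\<^sub>M X \<longrightarrow> (\<exists>!y. maps_to f x y))"

definition is_injection :: "'v \<Rightarrow> 'v \<Rightarrow> 'v \<Rightarrow> bool" where
  "is_injection f X Y \<longleftrightarrow>
     is_function f X Y \<and> (\<forall>x x' y. maps_to f x y \<and> maps_to f x' y \<longrightarrow> x = x')"

definition is_bijection :: "'v \<Rightarrow> 'v \<Rightarrow> 'v \<Rightarrow> bool" where
  "is_bijection f X Y \<longleftrightarrow>
     is_injection f X Y \<and> (\<forall>y. y \<in>\<^sub>M Y \<longrightarrow> (\<exists>x. maps_to f x y))"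

text \<open>\<open>B \<lless> A\<close>: the set \<open>A\<close> swallows \<open>B\<close>.\<close>

definition swallowed_by :: "'v \<Rightarrow> 'v \<Rightarrow> bool" where
  "swallowed_by B A \<longleftrightarrow> (\<exists>S f. is_disjoint_union S A B \<and> is_bijection f S A)"

end

text \<open>
  In the two schemes the valuation \<open>s\<close> supplies the parameters of the formula; variable 0 (and 1)
  are the distinguished ones.
\<close>

locale ZF_model =
  fixes E :: "'v \<Rightarrow> 'v \<Rightarrow> bool"  (infix \<open>\<in>\<^sub>M\<close> 50)
  assumes extensionality: "\<forall>x y. (\<forall>z. z \<in>\<^sub>M x \<longleftrightarrow> z \<in>\<^sub>M y) \<longrightarrow> x = y"
    and foundation: "\<forall>x. (\<exists>y. y \<in>\<^sub>M x) \<longrightarrow> (\<exists>y. y \<in>\<^sub>M x \<and> \<not> (\<exists>z. z \<in>\<^sub>M x \<and> z \<in>\<^sub>M y))"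
    and pairing: "\<forall>a b. \<exists>p. \<forall>x. x \<in>\<^sub>M p \<longleftrightarrow> x = a \<or> x = b"
    and union: "\<forall>F. \<exists>U. \<forall>x. x \<in>\<^sub>M U \<longleftrightarrow> (\<exists>y. y \<in>\<^sub>M F \<and> x \<in>\<^sub>M y)"
    and power_set: "\<forall>X. \<exists>P. \<forall>y. y \<in>\<^sub>M P \<longleftrightarrow> (\<forall>z. z \<in>\<^sub>M y \<longrightarrow> z \<in>\<^sub>M X)"
    and infinity: "\<exists>w. is_inductive E w"
    and separation:
      "\<forall>\<phi> s X. \<exists>Y. \<forall>x. x \<in>\<^sub>M Y \<longleftrightarrow> x \<in>\<^sub>M X \<and> sat E (s(0 := x)) \<phi>"
    and replacement:
      "\<forall>\<phi> s. (\<forall>x y y'. sat E (s(0 := x, 1 := y)) \<phi> \<and> sat E (s(0 := x, 1 := y')) \<phi> \<longrightarrow> y = y')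
         \<longrightarrow> (\<forall>X. \<exists>Y. \<forall>y. y \<in>\<^sub>M Y \<longleftrightarrow> (\<exists>x. x \<in>\<^sub>M X \<and> sat E (s(0 := x, 1 := y)) \<phi>))"

end

theory Submission
  imports Defs
begin

text \<open>
  If \<open>f\<close> is a bijection from \<open>A + B\<close> to \<open>A\<close>, write \<open>h = f(0, -)\<close> and \<open>k = f(1, -)\<close>; these are
  injections with disjoint ranges, so \<open>(b, n) \<mapsto> h\<^sup>n (k b)\<close> is an injection from \<open>B \<times> \<omega>\<close> into \<open>A\<close>.
  Conversely, given an injection \<open>g\<close> from \<open>B \<times> \<omega>\<close> into \<open>A\<close>, shift each row: send \<open>(1, b)\<close> to
  \<open>g(b, 0)\<close>, \<open>(0, g(b, n))\<close> to \<open>g(b, n + 1)\<close>, and \<open>(0, a)\<close> to \<open>a\<close> when \<open>a\<close> is not in the range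
  of \<open>g\<close>.

  Both arguments have to be carried out inside the model, so each set used must come from a
  first-order formula. Definable predicates are closed under the logical connectives, and this
  closure extracts the formulas from the shape of HOL predicates.
\<close>

section \<open>Renaming variables\<close>

primrec rename :: "(nat \<Rightarrow> nat) \<Rightarrow> fm \<Rightarrow> fm" where
  "rename f (Mem i j) = Mem (f i) (f j)"
| "rename f (Eq i j) = Eq (f i) (f j)"
| "rename f (Neg \<phi>) = Neg (rename f \<phi>)"
| "rename f (Conj \<phi> \<psi>) = Conj (rename f \<phi>) (rename f \<psi>)"
| "rename f (All i \<phi>) = All (f i) (rename f \<phi>)"

text \<open>A quantifier binding \<open>f i\<close> must change the renamed valuation at
  \<open>i\<close> only, which is where injectivity of \<open>f\<close> enters.\<close>

lemma sat_rename: "inj f \<Longrightarrow> sat E s (rename f \<phi>) \<longleftrightarrow> sat E (\<lambda>n. s (f n)) \<phi>"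
proof (induction \<phi> arbitrary: s)
  case (All i \<phi>)
  have "(\<lambda>n. (s(f i := a)) (f n)) = (\<lambda>n. s (f n))(i := a)" for a
    using All.prems by (auto simp: inj_eq)
  with All show ?case by simp
qed auto

definition interleave :: "(nat \<Rightarrow> 'a) \<Rightarrow> (nat \<Rightarrow> 'a) \<Rightarrow> nat \<Rightarrow> 'a" where
  "interleave s \<sigma> n = (if even n then s (n div 2) else \<sigma> (n div 2))"

lemma interleave_even [simp]: "interleave s \<sigma> (2 * n) = s n"
  and interleave_odd [simp]: "interleave s \<sigma> (Suc (2 * n)) = \<sigma> n"
  by (auto simp: interleave_def)

lemma parity_cases:
  fixes n :: nat
  obtains m where "n = 2 * m" | m where "n = Suc (2 * m)"
  by (metis Suc_eq_plus1 evenE oddE)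

lemma inj_interleave:
  assumes "inj f" "inj g" "\<And>m n. f m \<noteq> g n"
  shows "inj (interleave f g)"
proof (rule injI)
  fix x y assume "interleave f g x = interleave f g y"
  then show "x = y"
    by (cases x rule: parity_cases; cases y rule: parity_cases)
      (use assms in \<open>auto simp: inj_eq dest: not_sym\<close>)
qed

section \<open>Definability with parameters\<close>

context ZF_model
begin

text \<open>The even variables carry the arguments, the odd ones the parameters from the model.\<close>

definition definable :: "((nat \<Rightarrow> 'v) \<Rightarrow> bool) \<Rightarrow> bool" where
  "definable Q \<longleftrightarrow> (\<exists>\<phi> \<sigma>. \<forall>s. Q s \<longleftrightarrow> sat E (interleave s \<sigma>) \<phi>)"

text \<open>The language of set theory has no function symbols, so a term is represented by its
  graph: variable 0 holds the value and the arguments move up by one.\<close>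

definition definable_term :: "((nat \<Rightarrow> 'v) \<Rightarrow> 'v) \<Rightarrow> bool" where
  "definable_term t \<longleftrightarrow> definable (\<lambda>s. s 0 = t (\<lambda>n. s (Suc n)))"

lemma definable_rename:
  assumes "inj f" "definable Q"
  shows "definable (\<lambda>s. Q (\<lambda>n. s (f n)))"
proof -
  from assms(2) obtain \<phi> \<sigma> where \<phi>: "\<And>s. Q s \<longleftrightarrow> sat E (interleave s \<sigma>) \<phi>"
    by (auto simp: definable_def)
  \<comment> \<open>The renaming acts as \<open>f\<close> on the even variables and fixes the odd
    ones, so the parameters stay in place.\<close>
  let ?r = "interleave (\<lambda>n. 2 * f n) (\<lambda>n. Suc (2 * n))"
  have "inj ?r"
    by (rule inj_interleave) (use assms(1) in \<open>auto simp: inj_def, presburger\<close>)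
  moreover have "(\<lambda>n. interleave s \<sigma> (?r n)) = interleave (\<lambda>n. s (f n)) \<sigma>" for s
  proof
    fix n show "interleave s \<sigma> (?r n) = interleave (\<lambda>n. s (f n)) \<sigma> n"
      by (cases n rule: parity_cases) auto
  qed
  ultimately have "Q (\<lambda>n. s (f n)) \<longleftrightarrow> sat E (interleave s \<sigma>) (rename ?r \<phi>)" for s
    by (simp add: \<phi> sat_rename)
  then show ?thesis by (auto simp: definable_def)
qed

lemma definable_not: "definable Q \<Longrightarrow> definable (\<lambda>s. \<not> Q s)"
  unfolding definable_def by (metis sat.simps(3))

lemma definable_conj:
  assumes "definable P" "definable Q"
  shows "definable (\<lambda>s. P s \<and> Q s)"
proof -
  from assms obtain \<phi> \<sigma> \<psi> \<tau> where \<phi>: "\<And>s. P s \<longleftrightarrow> sat E (interleave s \<sigma>) \<phi>"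
    and \<psi>: "\<And>s. Q s \<longleftrightarrow> sat E (interleave s \<tau>) \<psi>"
    by (auto simp: definable_def)
  \<comment> \<open>The two formulas may come with different parameters. The odd variables are split
    once more: \<open>?f\<close> points to the half that holds \<open>\<sigma>\<close>,
    \<open>?g\<close> to the half that holds \<open>\<tau>\<close>.\<close>
  let ?f = "interleave (\<lambda>n. 2 * n) (\<lambda>n. Suc (2 * (2 * n)))"
  let ?g = "interleave (\<lambda>n. 2 * n) (\<lambda>n. Suc (2 * (Suc (2 * n))))"
  let ?\<rho> = "interleave \<sigma> \<tau>"
  have "inj ?f" "inj ?g"
    by (rule inj_interleave; auto simp: inj_def; presburger)+
  moreover have "(\<lambda>n. interleave s ?\<rho> (?f n)) = interleave s \<sigma>"
    and "(\<lambda>n. interleave s ?\<rho> (?g n)) = interleave s \<tau>" for s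
  proof -
    show "(\<lambda>n. interleave s ?\<rho> (?f n)) = interleave s \<sigma>"
    proof
      fix n show "interleave s ?\<rho> (?f n) = interleave s \<sigma> n"
        by (cases n rule: parity_cases) (simp_all only: interleave_even interleave_odd)
    qed
    show "(\<lambda>n. interleave s ?\<rho> (?g n)) = interleave s \<tau>"
    proof
      fix n show "interleave s ?\<rho> (?g n) = interleave s \<tau> n"
        by (cases n rule: parity_cases) (simp_all only: interleave_even interleave_odd)
    qed
  qed
  ultimately have "P s \<and> Q s \<longleftrightarrow>
      sat E (interleave s ?\<rho>) (Conj (rename ?f \<phi>) (rename ?g \<psi>))" for s
    by (simp add: \<phi> \<psi> sat_rename)
  then show ?thesis unfolding definable_def by blast
qed

text \<open>The hypothesis treats the bound variable as in de Bruijn notation: it becomes argument 0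
  and the others move up. In this form the rule can be applied to HOL quantifiers by
  unification.\<close>

lemma definable_all:
  assumes "definable (\<lambda>s. Q (s 0) (\<lambda>n. s (Suc n)))"
  shows "definable (\<lambda>s. \<forall>a. Q a s)"
proof -
  from assms obtain \<phi> \<sigma>
    where \<phi>: "\<And>s. Q (s 0) (\<lambda>n. s (Suc n)) \<longleftrightarrow> sat E (interleave s \<sigma>) \<phi>"
    by (auto simp: definable_def)
  \<comment> \<open>The bound variable is moved to variable 1, the first parameter slot; the
    arguments return to their places and the parameters move up by one slot. The entry
    \<open>\<sigma> 0\<close> in \<open>?\<sigma>\<close> is a dummy that the quantifier
    overwrites.\<close>
  let ?f = "interleave (case_nat 1 (\<lambda>n. 2 * n)) (\<lambda>n. Suc (2 * Suc n))"
  let ?\<sigma> = "case_nat (\<sigma> 0) \<sigma>"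
  have "inj ?f"
    by (rule inj_interleave) (auto simp: inj_def split: nat.split, presburger+)
  moreover have "(\<lambda>n. ((interleave s ?\<sigma>)(1 := a)) (?f n)) = interleave (case_nat a s) \<sigma>" for s a
  proof
    fix n
    show "((interleave s ?\<sigma>)(1 := a)) (?f n) = interleave (case_nat a s) \<sigma> n"
    proof (cases n rule: parity_cases)
      case (1 m)
      then show ?thesis by (cases m) (simp_all only: interleave_even nat.case fun_upd_def, simp_all)
    next
      case (2 m)
      then show ?thesis
        by (simp only: interleave_odd fun_upd_def) simp
    qed
  qed
  ultimately have "Q a s \<longleftrightarrow> sat E ((interleave s ?\<sigma>)(1 := a)) (rename ?f \<phi>)" for a s
    using \<phi>[of "case_nat a s"] by (simp add: sat_rename)
  then have "(\<forall>a. Q a s) \<longleftrightarrow> sat E (interleave s ?\<sigma>) (All 1 (rename ?f \<phi>))" for s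
    by simp
  then show ?thesis unfolding definable_def by blast
qed

lemma definable_disj:
  assumes "definable P" "definable Q"
  shows "definable (\<lambda>s. P s \<or> Q s)"
proof -
  have "definable (\<lambda>s. \<not> (\<not> P s \<and> \<not> Q s))"
    by (intro definable_not definable_conj assms)
  then show ?thesis by simp
qed

lemma definable_imp:
  assumes "definable P" "definable Q"
  shows "definable (\<lambda>s. P s \<longrightarrow> Q s)"
  unfolding imp_conv_disj by (intro definable_disj definable_not assms)

lemma definable_iff:
  assumes "definable P" "definable Q"
  shows "definable (\<lambda>s. P s \<longleftrightarrow> Q s)"
  unfolding iff_conv_conj_imp by (intro definable_conj definable_imp assms)

lemma definable_ex:
  assumes "definable (\<lambda>s. Q (s 0) (\<lambda>n. s (Suc n)))"
  shows "definable (\<lambda>s. \<exists>a. Q a s)"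
  using definable_not[OF definable_all[of "\<lambda>a s. \<not> Q a s", OF definable_not[OF assms]]] by simp

section \<open>Definable terms and atomic formulas\<close>

lemma definable_term_var: "definable_term (\<lambda>s. s i)"
proof -
  have "s 0 = s (Suc i) \<longleftrightarrow> sat E (interleave s \<sigma>) (Eq (2 * 0) (2 * Suc i))"
    for s \<sigma> :: "nat \<Rightarrow> 'v"
    by (simp only: sat.simps interleave_even)
  then show ?thesis unfolding definable_term_def definable_def by blast
qed

lemma definable_term_const: "definable_term (\<lambda>s. c)"
proof -
  have "s 0 = c \<longleftrightarrow> sat E (interleave s (\<lambda>_. c)) (Eq (2 * 0) (Suc (2 * 0)))" for s
    by (simp only: sat.simps interleave_even interleave_odd)
  then show ?thesis unfolding definable_term_def definable_def by blast
qed

text \<open>Needed when a term is moved under a quantifier: its arguments shift, while its value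
  stays at variable 0.\<close>

lemma definable_term_shift:
  assumes "definable_term t"
  shows "definable_term (\<lambda>s. t (\<lambda>n. s (Suc n)))"
proof -
  have "inj (case_nat 0 (\<lambda>n. Suc (Suc n)))" by (auto simp: inj_def split: nat.split)
  from definable_rename[OF this assms[unfolded definable_term_def]] show ?thesis
    by (simp add: definable_term_def)
qed

lemma definable_subst2:
  assumes "definable (\<lambda>s. Q (s (Suc 0)) (s 0))" "definable_term t" "definable_term u"
  shows "definable (\<lambda>s. Q (t s) (u s))"
proof -
  \<comment> \<open>The values of the two terms are named by quantifiers. The inner one takes
    variable 0 and pushes the outer one to variable \<open>Suc 0\<close>, hence the order in the
    first assumption.\<close>
  have "definable (\<lambda>s. \<exists>a. a = t s \<and> (\<exists>b. b = u s \<and> Q a b))"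
    using assms(2) definable_term_shift[OF assms(3)]
    by (intro definable_ex definable_conj assms(1)) (simp_all add: definable_term_def)
  then show ?thesis by simp
qed

lemma definable_mem:
  "definable_term t \<Longrightarrow> definable_term u \<Longrightarrow> definable (\<lambda>s. t s \<in>\<^sub>M u s)"
proof (rule definable_subst2)
  have "s (Suc 0) \<in>\<^sub>M s 0 \<longleftrightarrow> sat E (interleave s \<sigma>) (Mem (2 * Suc 0) (2 * 0))"
    for s \<sigma> :: "nat \<Rightarrow> 'v"
    by (simp only: sat.simps interleave_even)
  then show "definable (\<lambda>s. s (Suc 0) \<in>\<^sub>M s 0)" unfolding definable_def by blast
qed

lemma definable_eq:
  "definable_term t \<Longrightarrow> definable_term u \<Longrightarrow> definable (\<lambda>s. t s = u s)"
proof (rule definable_subst2)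
  have "s (Suc 0) = s 0 \<longleftrightarrow> sat E (interleave s \<sigma>) (Eq (2 * Suc 0) (2 * 0))"
    for s \<sigma> :: "nat \<Rightarrow> 'v"
    by (simp only: sat.simps interleave_even)
  then show "definable (\<lambda>s. s (Suc 0) = s 0)" unfolding definable_def by blast
qed

lemmas definable_basic = definable_not definable_conj definable_disj definable_imp definable_iff
  definable_all definable_ex definable_mem definable_eq definable_term_var definable_term_const

lemma definable_separation:
  assumes "definable (\<lambda>s. P (s 0))"
  shows "\<exists>Y. \<forall>x. x \<in>\<^sub>M Y \<longleftrightarrow> x \<in>\<^sub>M X \<and> P x"
proof -
  from assms obtain \<phi> \<sigma> where \<phi>: "\<And>s. P (s 0) \<longleftrightarrow> sat E (interleave s \<sigma>) \<phi>"
    by (auto simp: definable_def)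
  \<comment> \<open>Separation overwrites variable 0, which is argument 0. Since \<open>P\<close>
    looks at this argument alone, the remaining ones can be filled with \<open>X\<close>.\<close>
  have "(interleave (\<lambda>_. X) \<sigma>)(0 := x) = interleave (case_nat x (\<lambda>_. X)) \<sigma>" for x
    by (auto simp: interleave_def fun_eq_iff split: nat.split)
  with \<phi>[of "case_nat x (\<lambda>_. X)" for x] separation show ?thesis
    by (metis nat.case(1))
qed

section \<open>Pairs, products and natural numbers in the model\<close>

lemma set_eqI: "(\<And>z. z \<in>\<^sub>M x \<longleftrightarrow> z \<in>\<^sub>M y) \<Longrightarrow> x = y"
  using extensionality by blast

text \<open>Extensionality makes the described set unique, so a definite description is enough and
  no choice is involved.\<close>

definition upair :: "'v \<Rightarrow> 'v \<Rightarrow> 'v" where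
  "upair a b = (THE p. \<forall>x. x \<in>\<^sub>M p \<longleftrightarrow> x = a \<or> x = b)"

lemma mem_upair [simp]: "x \<in>\<^sub>M upair a b \<longleftrightarrow> x = a \<or> x = b"
proof -
  have "\<exists>!p. \<forall>x. x \<in>\<^sub>M p \<longleftrightarrow> x = a \<or> x = b"
    using pairing by (auto intro: set_eqI)
  from theI'[OF this] show ?thesis by (simp add: upair_def)
qed

definition un :: "'v \<Rightarrow> 'v \<Rightarrow> 'v" where
  "un X Y = (THE U. \<forall>x. x \<in>\<^sub>M U \<longleftrightarrow> x \<in>\<^sub>M X \<or> x \<in>\<^sub>M Y)"

lemma mem_un [simp]: "x \<in>\<^sub>M un X Y \<longleftrightarrow> x \<in>\<^sub>M X \<or> x \<in>\<^sub>M Y"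
proof -
  obtain U where "\<And>x. x \<in>\<^sub>M U \<longleftrightarrow> (\<exists>y. y \<in>\<^sub>M upair X Y \<and> x \<in>\<^sub>M y)"
    using union by blast
  then have "\<exists>!U. \<forall>x. x \<in>\<^sub>M U \<longleftrightarrow> x \<in>\<^sub>M X \<or> x \<in>\<^sub>M Y"
    by (intro ex1I[of _ U]) (auto intro!: set_eqI)
  from theI'[OF this] show ?thesis by (simp add: un_def)
qed

definition pair :: "'v \<Rightarrow> 'v \<Rightarrow> 'v" where
  "pair a b = upair (upair a a) (upair a b)"

definition succ :: "'v \<Rightarrow> 'v" where
  "succ x = un x (upair x x)"

definition zero :: 'v where
  "zero = (THE z. \<forall>x. \<not> x \<in>\<^sub>M z)"

lemma not_mem_zero [simp]: "\<not> x \<in>\<^sub>M zero"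
proof -
  \<comment> \<open>The axiom of infinity also supplies an empty set, as a member of an inductive
    set.\<close>
  obtain w z where "is_empty E z" "z \<in>\<^sub>M w" using infinity by (auto simp: is_inductive_def)
  then have "\<exists>!z. \<forall>x. \<not> x \<in>\<^sub>M z" by (auto simp: is_empty_def intro: set_eqI)
  from theI'[OF this] show ?thesis by (simp add: zero_def)
qed

lemma mem_succ [simp]: "x \<in>\<^sub>M succ y \<longleftrightarrow> x \<in>\<^sub>M y \<or> x = y"
  by (simp add: succ_def)

lemma upair_eq_iff: "upair a b = upair c d \<longleftrightarrow> a = c \<and> b = d \<or> a = d \<and> b = c"
proof
  assume "upair a b = upair c d"
  then show "a = c \<and> b = d \<or> a = d \<and> b = c" by (metis mem_upair)
qed (auto intro: set_eqI)

lemma pair_eq_iff [simp]: "pair a b = pair c d \<longleftrightarrow> a = c \<and> b = d"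
  by (auto simp: pair_def upair_eq_iff)

text \<open>By extensionality the graph is a first-order condition on the elements of the
  value.\<close>

lemma definable_term_upair:
  assumes "definable_term t" "definable_term u"
  shows "definable_term (\<lambda>s. upair (t s) (u s))"
proof -
  have "p = upair a b \<longleftrightarrow> (\<forall>x. x \<in>\<^sub>M p \<longleftrightarrow> x = a \<or> x = b)" for p a b
    by (auto intro: set_eqI)
  then show ?thesis
    unfolding definable_term_def
    by (auto intro!: definable_basic assms definable_term_shift)
qed

lemma definable_term_succ:
  assumes "definable_term t"
  shows "definable_term (\<lambda>s. succ (t s))"
proof -
  have "p = succ a \<longleftrightarrow> (\<forall>x. x \<in>\<^sub>M p \<longleftrightarrow> x \<in>\<^sub>M a \<or> x = a)" for p a
    by (auto intro: set_eqI)
  then show ?thesis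
    unfolding definable_term_def
    by (auto intro!: definable_basic assms definable_term_shift)
qed

lemma definable_term_pair:
  "definable_term t \<Longrightarrow> definable_term u \<Longrightarrow> definable_term (\<lambda>s. pair (t s) (u s))"
  unfolding pair_def by (intro definable_term_upair)

lemmas definable_intros = definable_basic definable_term_succ definable_term_pair

section \<open>The relational notions rewritten as equations between terms\<close>

lemma is_empty_iff: "is_empty E z \<longleftrightarrow> z = zero"
  by (auto simp: is_empty_def intro: set_eqI)

lemma is_succ_iff: "is_succ E s x \<longleftrightarrow> s = succ x"
  by (auto simp: is_succ_def intro: set_eqI)

lemma is_one_iff: "is_one E u \<longleftrightarrow> u = succ zero"
  by (simp add: is_one_def is_empty_iff is_succ_iff)

lemma is_upair_iff: "is_upair E p a b \<longleftrightarrow> p = upair a b"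
  by (auto simp: is_upair_def intro: set_eqI)

lemma is_pair_iff: "is_pair E p a b \<longleftrightarrow> p = pair a b"
  by (simp add: is_pair_def is_upair_iff pair_def)

lemma maps_to_iff: "maps_to E f x y \<longleftrightarrow> pair x y \<in>\<^sub>M f"
  by (simp add: maps_to_def is_pair_iff)

lemma is_inductive_iff:
  "is_inductive E w \<longleftrightarrow> zero \<in>\<^sub>M w \<and> (\<forall>x. x \<in>\<^sub>M w \<longrightarrow> succ x \<in>\<^sub>M w)"
  by (simp add: is_inductive_def is_empty_iff is_succ_iff)

lemma is_product_iff:
  "is_product E P X Y \<longleftrightarrow> (\<forall>p. p \<in>\<^sub>M P \<longleftrightarrow> (\<exists>x y. x \<in>\<^sub>M X \<and> y \<in>\<^sub>M Y \<and> p = pair x y))"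
  by (simp add: is_product_def is_pair_iff)

lemma is_disjoint_union_iff:
  "is_disjoint_union E S X Y \<longleftrightarrow>
    (\<forall>p. p \<in>\<^sub>M S \<longleftrightarrow> (\<exists>x. x \<in>\<^sub>M X \<and> p = pair zero x) \<or> (\<exists>y. y \<in>\<^sub>M Y \<and> p = pair (succ zero) y))"
  by (simp add: is_disjoint_union_def is_pair_iff is_empty_iff is_one_iff)

text \<open>A Kuratowski pair is a set of subsets of \<open>un X Y\<close>, so the double power set
  bounds the product and separation cuts it out.\<close>

lemma product_exists: "\<exists>P. is_product E P X Y"
proof -
  from power_set obtain Q where Q: "\<And>y. y \<in>\<^sub>M Q \<longleftrightarrow> (\<forall>z. z \<in>\<^sub>M y \<longrightarrow> z \<in>\<^sub>M un X Y)" by metis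
  from power_set obtain R where R: "\<And>y. y \<in>\<^sub>M R \<longleftrightarrow> (\<forall>z. z \<in>\<^sub>M y \<longrightarrow> z \<in>\<^sub>M Q)" by metis
  have mem: "pair x y \<in>\<^sub>M R" if "x \<in>\<^sub>M X" "y \<in>\<^sub>M Y" for x y
    using that by (auto simp: pair_def Q R)
  have "definable (\<lambda>s. \<exists>x y. x \<in>\<^sub>M X \<and> y \<in>\<^sub>M Y \<and> s 0 = pair x y)"
    by (intro definable_intros)
  then obtain P
    where "\<And>p. p \<in>\<^sub>M P \<longleftrightarrow> p \<in>\<^sub>M R \<and> (\<exists>x y. x \<in>\<^sub>M X \<and> y \<in>\<^sub>M Y \<and> p = pair x y)"
    by (rule definable_separation[of "\<lambda>p. \<exists>x y. x \<in>\<^sub>M X \<and> y \<in>\<^sub>M Y \<and> p = pair x y" R, THEN exE]) blast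
  with mem have "is_product E P X Y" unfolding is_product_iff by blast
  then show ?thesis by blast
qed

lemma disjoint_union_exists: "\<exists>S. is_disjoint_union E S X Y"
proof -
  \<comment> \<open>The product of {0, 1} with the union serves as the bounding set for
    separation.\<close>
  obtain P where P: "is_product E P (upair zero (succ zero)) (un X Y)"
    using product_exists by blast
  let ?D = "\<lambda>p. (\<exists>x. x \<in>\<^sub>M X \<and> p = pair zero x) \<or> (\<exists>y. y \<in>\<^sub>M Y \<and> p = pair (succ zero) y)"
  have "definable (\<lambda>s. ?D (s 0))"
    by (intro definable_intros)
  then obtain S where "\<And>p. p \<in>\<^sub>M S \<longleftrightarrow> p \<in>\<^sub>M P \<and> ?D p"
    by (rule definable_separation[of ?D P, THEN exE]) blast
  moreover have "?D p \<Longrightarrow> p \<in>\<^sub>M P" for p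
    using P unfolding is_product_iff by auto
  ultimately show ?thesis unfolding is_disjoint_union_iff by blast
qed

text \<open>The intersection of all inductive sets, cut out of one of them, is itself
  inductive.\<close>

lemma omega_exists: "\<exists>w. is_omega E w"
proof -
  obtain v where v: "is_inductive E v" using infinity by blast
  have "definable (\<lambda>s. \<forall>u. is_inductive E u \<longrightarrow> s 0 \<in>\<^sub>M u)"
    unfolding is_inductive_iff by (intro definable_intros)
  then obtain w where w: "\<And>x. x \<in>\<^sub>M w \<longleftrightarrow> x \<in>\<^sub>M v \<and> (\<forall>u. is_inductive E u \<longrightarrow> x \<in>\<^sub>M u)"
    by (rule definable_separation[of "\<lambda>x. \<forall>u. is_inductive E u \<longrightarrow> x \<in>\<^sub>M u" v, THEN exE]) blast
  have "is_inductive E w" using v by (auto simp: is_inductive_iff w)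
  then have "is_omega E w" by (simp add: is_omega_def w)
  then show ?thesis by blast
qed

lemma omega_zero: "is_omega E w \<Longrightarrow> zero \<in>\<^sub>M w"
  and omega_succ: "is_omega E w \<Longrightarrow> n \<in>\<^sub>M w \<Longrightarrow> succ n \<in>\<^sub>M w"
  unfolding is_omega_def is_inductive_iff by metis+

text \<open>The elements of \<open>w\<close> satisfying \<open>P\<close> must form a set of the
  model before minimality of \<open>w\<close> can be used. Hence only definable predicates are
  allowed; \<open>w\<close> may well contain nonstandard elements.\<close>

lemma omega_induct:
  assumes w: "is_omega E w" and n: "n \<in>\<^sub>M w"
    and P: "definable (\<lambda>s. P (s 0))"
    and zero: "P zero" and succ: "\<And>n. n \<in>\<^sub>M w \<Longrightarrow> P n \<Longrightarrow> P (succ n)"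
  shows "P n"
proof -
  obtain Y where Y: "\<And>x. x \<in>\<^sub>M Y \<longleftrightarrow> x \<in>\<^sub>M w \<and> P x"
    using definable_separation[of P w, OF P] by blast
  have "is_inductive E Y"
    using omega_zero[OF w] omega_succ[OF w] zero succ by (simp add: is_inductive_iff Y)
  with w n have "n \<in>\<^sub>M Y" unfolding is_omega_def by metis
  with Y show ?thesis by metis
qed

lemma omega_cases:
  assumes "is_omega E w" "n \<in>\<^sub>M w"
  obtains "n = zero" | m where "m \<in>\<^sub>M w" "n = succ m"
proof -
  have "definable (\<lambda>s. s 0 = zero \<or> (\<exists>m. m \<in>\<^sub>M w \<and> s 0 = succ m))"
    by (intro definable_intros)
  then have "n = zero \<or> (\<exists>m. m \<in>\<^sub>M w \<and> n = succ m)"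
    by (rule omega_induct[OF assms]) auto
  with that show ?thesis by blast
qed

lemma succ_neq_zero [simp]: "succ n \<noteq> zero" "zero \<noteq> succ n"
  by (metis mem_succ not_mem_zero)+

lemma succ_eq_iff [simp]: "succ m = succ n \<longleftrightarrow> m = n"
proof
  assume eq: "succ m = succ n"
  \<comment> \<open>If \<open>m\<close> and \<open>n\<close> differed, equal successors would make
    each a member of the other; foundation for {m, n} forbids this.\<close>
  have "\<not> (m \<in>\<^sub>M n \<and> n \<in>\<^sub>M m)"
    using spec[OF foundation, of "upair m n"] by auto
  with eq show "m = n" by (metis mem_succ)
qed simp

section \<open>Functions in the model\<close>

text \<open>Lets later arguments compute with a HOL function \<open>F\<close>, while formulas keep
  referring to the set \<open>f\<close>.\<close>

lemma is_functionE:
  assumes "is_function E f X Y"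
  obtains F where "\<And>x. x \<in>\<^sub>M X \<Longrightarrow> F x \<in>\<^sub>M Y" "\<And>x y. pair x y \<in>\<^sub>M f \<longleftrightarrow> x \<in>\<^sub>M X \<and> y = F x"
proof
  let ?F = "\<lambda>x. THE y. pair x y \<in>\<^sub>M f"
  have dom: "x \<in>\<^sub>M X \<and> y \<in>\<^sub>M Y" if "pair x y \<in>\<^sub>M f" for x y
    using assms that unfolding is_function_def is_pair_iff by fastforce
  have ex1: "\<exists>!y. pair x y \<in>\<^sub>M f" if "x \<in>\<^sub>M X" for x
    using assms that by (simp add: is_function_def maps_to_iff)
  show graph: "pair x y \<in>\<^sub>M f \<longleftrightarrow> x \<in>\<^sub>M X \<and> y = ?F x" for x y
    using dom theI'[OF ex1] the1_equality[OF ex1] by metis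
  show "?F x \<in>\<^sub>M Y" if "x \<in>\<^sub>M X" for x
    using graph dom that by blast
qed

text \<open>The way back into the model: \<open>R\<close> supplies the formula and \<open>F\<close>
  the intended values. Since \<open>f\<close> is cut out of the product of \<open>X\<close> and
  \<open>Y\<close>, \<open>R\<close> need agree with \<open>F\<close> only on
  \<open>X\<close>.\<close>

lemma definable_function:
  assumes R: "definable (\<lambda>s. R (s (Suc 0)) (s 0))"
    and F: "\<And>x. x \<in>\<^sub>M X \<Longrightarrow> F x \<in>\<^sub>M Y"
    and graph: "\<And>x y. x \<in>\<^sub>M X \<Longrightarrow> R x y \<longleftrightarrow> y = F x"
  obtains f where "is_function E f X Y" "\<And>x y. pair x y \<in>\<^sub>M f \<longleftrightarrow> x \<in>\<^sub>M X \<and> y = F x"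
proof -
  obtain P where P: "is_product E P X Y" using product_exists by blast
  have "definable (\<lambda>s. \<exists>x y. s 0 = pair x y \<and> R x y)"
    by (intro definable_intros R)
  then obtain f where f: "\<And>p. p \<in>\<^sub>M f \<longleftrightarrow> p \<in>\<^sub>M P \<and> (\<exists>x y. p = pair x y \<and> R x y)"
    by (rule definable_separation[of "\<lambda>p. \<exists>x y. p = pair x y \<and> R x y" P, THEN exE]) blast
  have mem: "pair x y \<in>\<^sub>M f \<longleftrightarrow> x \<in>\<^sub>M X \<and> y = F x" for x y
    using P F graph by (auto simp: f is_product_iff)
  moreover have "is_function E f X Y"
    using P by (auto simp: is_function_def maps_to_iff is_pair_iff mem) (auto simp: f is_product_iff)
  ultimately show ?thesis using that by blast
qed

section \<open>Swallowing and injections of \<open>B \<times> \<omega>\<close>\<close>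

lemma swallowed_by_if_injection:
  assumes w: "is_omega E w" and P: "is_product E P B w" and g: "is_injection E g P A"
  shows "swallowed_by E B A"
proof -
  have "is_function E g P A" using g by (simp add: is_injection_def)
  then obtain H where HA: "\<And>x. x \<in>\<^sub>M P \<Longrightarrow> H x \<in>\<^sub>M A"
    and H: "\<And>x y. pair x y \<in>\<^sub>M g \<longleftrightarrow> x \<in>\<^sub>M P \<and> y = H x"
    by (rule is_functionE) blast
  have H_inj: "x = y" if "x \<in>\<^sub>M P" "y \<in>\<^sub>M P" "H x = H y" for x y
    using g that by (auto simp: is_injection_def maps_to_iff H)
  define G where "G b n = H (pair b n)" for b n
  have G: "pair p y \<in>\<^sub>M g \<longleftrightarrow> (\<exists>b n. p = pair b n \<and> b \<in>\<^sub>M B \<and> n \<in>\<^sub>M w \<and> y = G b n)" for p y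
    using P by (auto simp: H G_def is_product_iff)
  have GA: "G b n \<in>\<^sub>M A" if "b \<in>\<^sub>M B" "n \<in>\<^sub>M w" for b n
    using HA P that by (auto simp: G_def is_product_iff)
  have G_inj: "b = b' \<and> n = n'"
    if "b \<in>\<^sub>M B" "n \<in>\<^sub>M w" "b' \<in>\<^sub>M B" "n' \<in>\<^sub>M w" "G b n = G b' n'" for b n b' n'
    using H_inj[of "pair b n" "pair b' n'"] P that by (auto simp: G_def is_product_iff)
  note w_zero = omega_zero[OF w] and w_succ = omega_succ[OF w]
  obtain S where S: "is_disjoint_union E S A B" using disjoint_union_exists by blast
  \<comment> \<open>The row shift is expressed through membership in \<open>g\<close> instead of
    through \<open>G\<close>, so that it is visibly a formula with parameter
    \<open>g\<close>.\<close>
  define R where "R x y \<longleftrightarrow>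
      (\<exists>a. x = pair zero a \<and>
        ((\<exists>b n. pair (pair b n) a \<in>\<^sub>M g \<and> pair (pair b (succ n)) y \<in>\<^sub>M g) \<or>
         \<not> (\<exists>p. pair p a \<in>\<^sub>M g) \<and> y = a)) \<or>
      (\<exists>b. x = pair (succ zero) b \<and> pair (pair b zero) y \<in>\<^sub>M g)" for x y
  have R_def': "definable (\<lambda>s. R (s (Suc 0)) (s 0))"
    unfolding R_def by (intro definable_intros)
  have R_row: "R (pair zero (G b n)) y \<longleftrightarrow> y = G b (succ n)" if "b \<in>\<^sub>M B" "n \<in>\<^sub>M w" for b n y
    using that w_succ by (auto simp: R_def G dest: G_inj)
  have R_fix: "R (pair zero a) y \<longleftrightarrow> y = a" if "\<nexists>b n. b \<in>\<^sub>M B \<and> n \<in>\<^sub>M w \<and> a = G b n" for a y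
    using that by (auto simp: R_def G)
  have R_new: "R (pair (succ zero) b) y \<longleftrightarrow> y = G b zero" if "b \<in>\<^sub>M B" for b y
    using that w_zero by (auto simp: R_def G)
  define F where "F x = (THE y. R x y)" for x
  have F_row: "F (pair zero (G b n)) = G b (succ n)" if "b \<in>\<^sub>M B" "n \<in>\<^sub>M w" for b n
    by (simp add: F_def R_row that)
  have F_fix: "F (pair zero a) = a" if "\<nexists>b n. b \<in>\<^sub>M B \<and> n \<in>\<^sub>M w \<and> a = G b n" for a
    by (simp only: F_def R_fix[OF that] the_eq_trivial)
  have F_new: "F (pair (succ zero) b) = G b zero" if "b \<in>\<^sub>M B" for b
    by (simp add: F_def R_new that)
  \<comment> \<open>These three kinds of elements match the clauses of \<open>R\<close>: in a row,
    outside all rows, newly added.\<close>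
  have S_cases: thesis if "x \<in>\<^sub>M S"
    "\<And>b n. b \<in>\<^sub>M B \<Longrightarrow> n \<in>\<^sub>M w \<Longrightarrow> x = pair zero (G b n) \<Longrightarrow> thesis"
    "\<And>a. a \<in>\<^sub>M A \<Longrightarrow> \<nexists>b n. b \<in>\<^sub>M B \<and> n \<in>\<^sub>M w \<and> a = G b n \<Longrightarrow> x = pair zero a \<Longrightarrow> thesis"
    "\<And>b. b \<in>\<^sub>M B \<Longrightarrow> x = pair (succ zero) b \<Longrightarrow> thesis" for x thesis
    using S that unfolding is_disjoint_union_iff by metis
  have FA: "F x \<in>\<^sub>M A" if "x \<in>\<^sub>M S" for x
    using that by (rule S_cases) (simp_all add: F_row F_fix F_new GA w_zero w_succ)
  have RF: "R x y \<longleftrightarrow> y = F x" if "x \<in>\<^sub>M S" for x y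
    using that by (rule S_cases) (simp_all add: F_row F_fix F_new R_row R_fix R_new)
  obtain f where f: "is_function E f S A" and mem_f: "\<And>x y. pair x y \<in>\<^sub>M f \<longleftrightarrow> x \<in>\<^sub>M S \<and> y = F x"
    using definable_function[OF R_def' FA RF] by blast
  \<comment> \<open>Elements of the same kind are separated by \<open>G_inj\<close> or by
    \<open>F_fix\<close>. For different kinds, values at index \<open>succ n\<close> differ from
    those at \<open>zero\<close>, and a fixed point lies outside the range of
    \<open>G\<close>.\<close>
  have F_inj: "x = x'" if "x \<in>\<^sub>M S" "x' \<in>\<^sub>M S" "F x = F x'" for x x'
    using that(1)
  proof (rule S_cases)
    fix b n assume x: "b \<in>\<^sub>M B" "n \<in>\<^sub>M w" "x = pair zero (G b n)"
    show ?thesis using that(2)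
    proof (rule S_cases)
      fix b' n' assume "b' \<in>\<^sub>M B" "n' \<in>\<^sub>M w" "x' = pair zero (G b' n')"
      with x that(3) G_inj[of b "succ n" b' "succ n'"] show ?thesis
        by (simp add: F_row w_succ)
    next
      fix a assume "\<nexists>b n. b \<in>\<^sub>M B \<and> n \<in>\<^sub>M w \<and> a = G b n" "x' = pair zero a"
      with x that(3) w_succ show ?thesis by (metis F_row F_fix)
    next
      fix b' assume "b' \<in>\<^sub>M B" "x' = pair (succ zero) b'"
      with x that(3) G_inj[of b "succ n" b' zero] show ?thesis
        by (simp add: F_row F_new w_succ w_zero)
    qed
  next
    fix a assume a: "\<nexists>b n. b \<in>\<^sub>M B \<and> n \<in>\<^sub>M w \<and> a = G b n" "x = pair zero a"
    show ?thesis using that(2)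
    proof (rule S_cases)
      fix b' n' assume "b' \<in>\<^sub>M B" "n' \<in>\<^sub>M w" "x' = pair zero (G b' n')"
      with a that(3) w_succ show ?thesis by (metis F_row F_fix)
    next
      fix a' assume "\<nexists>b n. b \<in>\<^sub>M B \<and> n \<in>\<^sub>M w \<and> a' = G b n" "x' = pair zero a'"
      with a that(3) show ?thesis by (metis F_fix)
    next
      fix b' assume "b' \<in>\<^sub>M B" "x' = pair (succ zero) b'"
      with a that(3) w_zero show ?thesis by (metis F_fix F_new)
    qed
  next
    fix b assume x: "b \<in>\<^sub>M B" "x = pair (succ zero) b"
    show ?thesis using that(2)
    proof (rule S_cases)
      fix b' n' assume "b' \<in>\<^sub>M B" "n' \<in>\<^sub>M w" "x' = pair zero (G b' n')"
      with x that(3) G_inj[of b zero b' "succ n'"] show ?thesis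
        by (simp add: F_row F_new w_succ w_zero)
    next
      fix a assume "\<nexists>b n. b \<in>\<^sub>M B \<and> n \<in>\<^sub>M w \<and> a = G b n" "x' = pair zero a"
      with x that(3) w_zero show ?thesis by (metis F_fix F_new)
    next
      fix b' assume "b' \<in>\<^sub>M B" "x' = pair (succ zero) b'"
      with x that(3) G_inj[of b zero b' zero] show ?thesis
        by (simp add: F_new w_zero)
    qed
  qed
  have F_surj: "\<exists>x. x \<in>\<^sub>M S \<and> y = F x" if "y \<in>\<^sub>M A" for y
  proof (cases "\<exists>b n. b \<in>\<^sub>M B \<and> n \<in>\<^sub>M w \<and> y = G b n")
    case True
    then obtain b n where bn: "b \<in>\<^sub>M B" "n \<in>\<^sub>M w" "y = G b n" by blast
    \<comment> \<open>The start of a row is the image of the new element \<open>b\<close>; any later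
      entry is the shift of its predecessor.\<close>
    from w bn(2) show ?thesis
    proof (cases rule: omega_cases)
      case 1
      with bn S F_new[of b] show ?thesis
        by (intro exI[of _ "pair (succ zero) b"]) (auto simp: is_disjoint_union_iff)
    next
      case (2 m)
      with bn S F_row[of b m] GA[of b m] show ?thesis
        by (intro exI[of _ "pair zero (G b m)"]) (auto simp: is_disjoint_union_iff)
    qed
  next
    case False
    with that S F_fix[of y] show ?thesis
      by (intro exI[of _ "pair zero y"]) (auto simp: is_disjoint_union_iff)
  qed
  have "is_bijection E f S A"
    using f F_inj F_surj by (auto simp: is_bijection_def is_injection_def maps_to_iff mem_f)
  with S show ?thesis by (auto simp: swallowed_by_def)
qed

lemma injection_if_swallowed_by:
  assumes "swallowed_by E B A"
  shows "\<exists>w P g. is_omega E w \<and> is_product E P B w \<and> is_injection E g P A"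
proof -
  obtain S f where S: "is_disjoint_union E S A B" and f: "is_bijection E f S A"
    using assms by (auto simp: swallowed_by_def)
  have "is_function E f S A" using f by (simp add: is_bijection_def is_injection_def)
  then obtain F where FA: "\<And>x. x \<in>\<^sub>M S \<Longrightarrow> F x \<in>\<^sub>M A"
    and F: "\<And>x y. pair x y \<in>\<^sub>M f \<longleftrightarrow> x \<in>\<^sub>M S \<and> y = F x"
    by (rule is_functionE) blast
  have F_inj: "x = y" if "x \<in>\<^sub>M S" "y \<in>\<^sub>M S" "F x = F y" for x y
    using f that by (auto simp: is_bijection_def is_injection_def maps_to_iff F)
  have S_left: "pair zero a \<in>\<^sub>M S \<longleftrightarrow> a \<in>\<^sub>M A" and S_right: "pair (succ zero) b \<in>\<^sub>M S \<longleftrightarrow> b \<in>\<^sub>M B"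
    for a b using S by (auto simp: is_disjoint_union_iff)
  define h where "h a = F (pair zero a)" for a
  define k where "k b = F (pair (succ zero) b)" for b
  have hA: "a \<in>\<^sub>M A \<Longrightarrow> h a \<in>\<^sub>M A" and kA: "b \<in>\<^sub>M B \<Longrightarrow> k b \<in>\<^sub>M A" for a b
    by (simp_all add: h_def k_def FA S_left S_right)
  have h_inj: "h a = h a' \<Longrightarrow> a = a'" if "a \<in>\<^sub>M A" "a' \<in>\<^sub>M A" for a a'
    using F_inj[of "pair zero a" "pair zero a'"] that by (simp add: h_def S_left)
  have k_inj: "k b = k b' \<Longrightarrow> b = b'" if "b \<in>\<^sub>M B" "b' \<in>\<^sub>M B" for b b'
    using F_inj[of "pair (succ zero) b" "pair (succ zero) b'"] that by (simp add: k_def S_right)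
  have h_neq_k: "h a \<noteq> k b" if "a \<in>\<^sub>M A" "b \<in>\<^sub>M B" for a b
    using F_inj[of "pair zero a" "pair (succ zero) b"] that by (auto simp: h_def k_def S_left S_right)
  \<comment> \<open>Formulas can take \<open>f\<close> as a parameter, but not the HOL functions
    \<open>h\<close> and \<open>k\<close>; these equations pass between the two.\<close>
  have h_graph: "pair (pair zero a) y \<in>\<^sub>M f \<longleftrightarrow> a \<in>\<^sub>M A \<and> y = h a" for a y
    by (simp add: F S_left h_def)
  have k_graph: "pair (pair (succ zero) b) y \<in>\<^sub>M f \<longleftrightarrow> b \<in>\<^sub>M B \<and> y = k b" for b y
    by (simp add: F S_right k_def)

  obtain w where w: "is_omega E w" using omega_exists by blast
  note w_zero = omega_zero[OF w] and w_succ = omega_succ[OF w]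
  obtain P where P: "is_product E P B w" using product_exists by blast
  \<comment> \<open>The ambient set from which the graph of the iteration will be separated.\<close>
  obtain Q where Q: "is_product E Q P A" using product_exists by blast
  have mem_Q: "pair (pair b n) a \<in>\<^sub>M Q \<longleftrightarrow> b \<in>\<^sub>M B \<and> n \<in>\<^sub>M w \<and> a \<in>\<^sub>M A" for b n a
    using P Q by (auto simp: is_product_iff)

  \<comment> \<open>The iteration \<open>(b, n) \<mapsto> h\<^sup>n (k b)\<close> is the least set closed under its recursion equations;
    this replaces a recursion theorem for \<open>\<omega>\<close>.\<close>
  define closed where "closed G \<longleftrightarrow>
      (\<forall>b y. pair (pair (succ zero) b) y \<in>\<^sub>M f \<longrightarrow> pair (pair b zero) y \<in>\<^sub>M G) \<and>
      (\<forall>b n a y. n \<in>\<^sub>M w \<and> pair (pair b n) a \<in>\<^sub>M G \<and> pair (pair zero a) y \<in>\<^sub>M f \<longrightarrow>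
        pair (pair b (succ n)) y \<in>\<^sub>M G)" for G
  have closed_iff: "closed G \<longleftrightarrow> (\<forall>b. b \<in>\<^sub>M B \<longrightarrow> pair (pair b zero) (k b) \<in>\<^sub>M G) \<and>
      (\<forall>b n a. n \<in>\<^sub>M w \<and> a \<in>\<^sub>M A \<and> pair (pair b n) a \<in>\<^sub>M G \<longrightarrow> pair (pair b (succ n)) (h a) \<in>\<^sub>M G)"
    for G by (auto simp: closed_def h_graph k_graph)
  have "definable (\<lambda>s. \<forall>G. closed G \<longrightarrow> s 0 \<in>\<^sub>M G)"
    unfolding closed_def by (intro definable_intros)
  then obtain g where g: "\<And>p. p \<in>\<^sub>M g \<longleftrightarrow> p \<in>\<^sub>M Q \<and> (\<forall>G. closed G \<longrightarrow> p \<in>\<^sub>M G)"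
    by (rule definable_separation[of "\<lambda>p. \<forall>G. closed G \<longrightarrow> p \<in>\<^sub>M G" Q, THEN exE]) blast
  have g_zero: "pair (pair b zero) (k b) \<in>\<^sub>M g" if "b \<in>\<^sub>M B" for b
    using that by (auto simp: g mem_Q w_zero kA closed_iff)
  have g_succ: "pair (pair b (succ n)) (h a) \<in>\<^sub>M g" if "pair (pair b n) a \<in>\<^sub>M g" for b n a
    using that by (auto simp: g mem_Q w_succ hA closed_iff)
  have g_mem: "b \<in>\<^sub>M B \<and> n \<in>\<^sub>M w \<and> a \<in>\<^sub>M A" if "pair (pair b n) a \<in>\<^sub>M g" for b n a
    using that by (simp add: g mem_Q)
  have g_cases: "n = zero \<and> a = k b \<or>
      (\<exists>m a'. n = succ m \<and> a = h a' \<and> pair (pair b m) a' \<in>\<^sub>M g)"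
    if bna: "pair (pair b n) a \<in>\<^sub>M g" for b n a
  proof -
    \<comment> \<open>Inversion by minimality: the members of \<open>g\<close> produced by one of
      the two equations already form a closed set, so they exhaust \<open>g\<close>.\<close>
    let ?C = "\<lambda>p. \<exists>b n a. p = pair (pair b n) a \<and>
      (n = zero \<and> pair (pair (succ zero) b) a \<in>\<^sub>M f \<or>
       (\<exists>m a'. n = succ m \<and> pair (pair zero a') a \<in>\<^sub>M f \<and> pair (pair b m) a' \<in>\<^sub>M g))"
    have "definable (\<lambda>s. ?C (s 0))" by (intro definable_intros)
    then obtain G where G: "\<And>p. p \<in>\<^sub>M G \<longleftrightarrow> p \<in>\<^sub>M g \<and> ?C p"
      by (rule definable_separation[of ?C g, THEN exE]) blast
    have "closed G"
      unfolding closed_iff using g_zero g_succ by (auto simp: G h_graph k_graph)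
    with bna have "pair (pair b n) a \<in>\<^sub>M G" using g by blast
    then have "?C (pair (pair b n) a)" using G by blast
    then show ?thesis by (auto simp: h_graph k_graph)
  qed
  have g_ex: "\<exists>a. pair (pair b n) a \<in>\<^sub>M g" if "b \<in>\<^sub>M B" "n \<in>\<^sub>M w" for b n
  proof -
    have "definable (\<lambda>s. \<exists>a. pair (pair b (s 0)) a \<in>\<^sub>M g)" by (intro definable_intros)
    then show ?thesis
      by (rule omega_induct[OF w that(2)]) (use that(1) g_zero g_succ in blast)+
  qed
  have g_unique: "\<forall>a a'. pair (pair b n) a \<in>\<^sub>M g \<and> pair (pair b n) a' \<in>\<^sub>M g \<longrightarrow> a = a'"
    if "n \<in>\<^sub>M w" for b n
  proof -
    have "definable (\<lambda>s. \<forall>a a'. pair (pair b (s 0)) a \<in>\<^sub>M g \<and> pair (pair b (s 0)) a' \<in>\<^sub>M g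
        \<longrightarrow> a = a')"
      by (intro definable_intros)
    then show ?thesis
    \<comment> \<open>As \<open>zero\<close> is not a successor and \<open>succ\<close> is
      injective, \<open>g_cases\<close> leaves exactly one equation for each index.\<close>
    proof (rule omega_induct[OF w that], goal_cases)
      case 1
      show ?case by (metis g_cases succ_neq_zero(1))
    next
      case (2 n)
      then show ?case by (metis g_cases succ_eq_iff succ_neq_zero(1))
    qed
  qed
  \<comment> \<open>The index \<open>n'\<close> is quantified inside the induction, because each
    step removes one \<open>h\<close> on both sides and so lowers both indices.\<close>
  have g_inj: "\<forall>b b' n' a. pair (pair b n) a \<in>\<^sub>M g \<and> pair (pair b' n') a \<in>\<^sub>M g \<longrightarrow> b = b' \<and> n = n'"
    if "n \<in>\<^sub>M w" for n
  proof -
    have "definable (\<lambda>s. \<forall>b b' n' a. pair (pair b (s 0)) a \<in>\<^sub>M g \<and> pair (pair b' n') a \<in>\<^sub>M g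
        \<longrightarrow> b = b' \<and> s 0 = n')"
      by (intro definable_intros)
    then show ?thesis
    proof (rule omega_induct[OF w that], goal_cases)
      case 1
      show ?case
        by (metis g_cases g_mem h_neq_k k_inj succ_neq_zero(1))
    next
      case (2 n)
      show ?case
      proof (intro allI impI, elim conjE)
        fix b b' n' a
        assume a: "pair (pair b (succ n)) a \<in>\<^sub>M g" "pair (pair b' n') a \<in>\<^sub>M g"
        \<comment> \<open>A value of \<open>h\<close> is never a value of \<open>k\<close>, so
          \<open>n'\<close> must be a successor too; then \<open>h_inj\<close> identifies the two
          preimages.\<close>
        from g_cases[OF a(1)] obtain c where c: "a = h c" "pair (pair b n) c \<in>\<^sub>M g" by auto
        with g_cases[OF a(2)] h_neq_k[of c b'] g_mem[OF a(2)] g_mem[OF c(2)]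
        obtain m c' where c': "n' = succ m" "a = h c'" "pair (pair b' m) c' \<in>\<^sub>M g" by auto
        have "c = c'" using h_inj c c' g_mem by metis
        with 2(2) c c' show "b = b' \<and> succ n = n'" by blast
      qed
    qed
  qed
  have "is_injection E g P A"
    unfolding is_injection_def is_function_def maps_to_iff is_pair_iff
  proof (intro conjI allI impI)
    fix p assume "p \<in>\<^sub>M g"
    with Q show "\<exists>x y. x \<in>\<^sub>M P \<and> y \<in>\<^sub>M A \<and> p = pair x y" by (simp add: g is_product_iff)
  next
    fix x assume "x \<in>\<^sub>M P"
    with P obtain b n where "b \<in>\<^sub>M B" "n \<in>\<^sub>M w" "x = pair b n" by (auto simp: is_product_iff)
    with g_ex g_unique show "\<exists>!y. pair x y \<in>\<^sub>M g" by metis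
  next
    fix x x' y assume xy: "pair x y \<in>\<^sub>M g \<and> pair x' y \<in>\<^sub>M g"
    with Q have "x \<in>\<^sub>M P" "x' \<in>\<^sub>M P" by (auto simp: g is_product_iff)
    with P obtain b n b' n' where "x = pair b n" "x' = pair b' n'" "n \<in>\<^sub>M w"
      by (auto simp: is_product_iff)
    with xy g_inj show "x = x'" by blast
  qed
  with w P show ?thesis by blast
qed

end

theorem mainTheorem4:
  fixes E :: "'v \<Rightarrow> 'v \<Rightarrow> bool" and A B :: 'v
  assumes "ZF_model E"
  shows "swallowed_by E B A \<longleftrightarrow>
    (\<exists>\<omega> P g. is_omega E \<omega> \<and> is_product E P B \<omega> \<and> is_injection E g P A)"
  using ZF_model.injection_if_swallowed_by[OF assms]
    ZF_model.swallowed_by_if_injection[OF assms] by blast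

end
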